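(* Let $G$ be a nontrivial traceable graph and let $H$ be a nontrivial connected graph whose maximum degree equals $|V(H)|-1$. Then $tpc(G\square H)=3$.
   Context: All graphs are simple, finite and undirected. A graph is traceable if it has a Hamiltonian path (a path containing every vertex); nontrivial means having at least two vertices. A graph is total-colored if all its vertices and edges are assigned colors. A path in a total-colored graph is a total proper path if (i) any two adjacent edges on the path differ in color, (ii) any two adjacent internal vertices of the path differ in color, and (iii) every internal vertex of the path differs in color from the edges of the path incident with it. A total-colored graph is total-proper connected if any two vertices are joined by a total proper path. For a connected graph $G$, $tpc(G)$ is the smallest number of colors in a total-coloring making $G$ total-proper connected. The Cartesian product $G\square H$ has vertex set $V(G)\times V(H)$, with $(g,h)$ adjacent to $(g',h')$ iff either $g=g'$ and $hh'\in E(H)$, or $h=h'$ and $gg'\in E(G)$. *)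

theory Defs
  imports Complex_Main "Graph_Theory.Graph_Theory"
begin

text \<open>
  Finite simple undirected graphs are the \<^locale>\<open>pair_graph\<close>s of Graph_Theory: the edge
  \<open>uv\<close> is represented by the two arcs \<open>(u, v)\<close> and \<open>(v, u)\<close>. In particular
  \<^const>\<open>out_degree\<close> is the usual degree, and \<^const>\<open>vpath\<close> holds of the nonempty,
  repetition-free vertex sequences whose consecutive vertices are adjacent.
\<close>

definition edges :: "'a pair_pre_digraph \<Rightarrow> 'a set set" where
  "edges G = {{u, v} | u v. (u, v) \<in> parcs G}"

definition max_degree :: "'a pair_pre_digraph \<Rightarrow> nat" where
  "max_degree G = Max (out_degree (with_proj G) ` pverts G)"

definition traceable :: "'a pair_pre_digraph \<Rightarrow> bool" where
  "traceable G \<longleftrightarrow> (\<exists>p. vpath p (with_proj G) \<and> set p = pverts G)"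

definition cartesian_product ::
  "'a pair_pre_digraph \<Rightarrow> 'b pair_pre_digraph \<Rightarrow> ('a \<times> 'b) pair_pre_digraph" where
  "cartesian_product G H =
     \<lparr> pverts = pverts G \<times> pverts H,
       parcs = {((g, h), (g', h')) | g h g' h'.
                  g \<in> pverts G \<and> g' \<in> pverts G \<and> h \<in> pverts H \<and> h' \<in> pverts H \<and>
                  (g = g' \<and> (h, h') \<in> parcs H \<or> h = h' \<and> (g, g') \<in> parcs G)} \<rparr>"

text \<open>
  A total-coloring is a pair of functions \<open>cv\<close>, \<open>ce\<close>; only the values of \<open>cv\<close> on vertices and
  of \<open>ce\<close> on edges (as two-element sets) matter. The internal vertices of the path \<open>p\<close> are the
  \<open>p ! i\<close> with \<open>0 < i\<close> and \<open>i + 1 < length p\<close>. Adjacency of edges and of internal vertices is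
  adjacency along the path.
\<close>

definition total_proper_path ::
  "'a pair_pre_digraph \<Rightarrow> ('a \<Rightarrow> nat) \<Rightarrow> ('a set \<Rightarrow> nat) \<Rightarrow> 'a list \<Rightarrow> bool" where
  "total_proper_path G cv ce p \<longleftrightarrow>
     vpath p (with_proj G) \<and>
     (\<forall>i. i + 2 < length p \<longrightarrow> ce {p ! i, p ! (i + 1)} \<noteq> ce {p ! (i + 1), p ! (i + 2)}) \<and>
     (\<forall>i. 0 < i \<and> i + 2 < length p \<longrightarrow> cv (p ! i) \<noteq> cv (p ! (i + 1))) \<and>
     (\<forall>i. 0 < i \<and> i + 1 < length p \<longrightarrow>
        cv (p ! i) \<noteq> ce {p ! (i - 1), p ! i} \<and> cv (p ! i) \<noteq> ce {p ! i, p ! (i + 1)})"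

definition total_proper_connected ::
  "'a pair_pre_digraph \<Rightarrow> ('a \<Rightarrow> nat) \<Rightarrow> ('a set \<Rightarrow> nat) \<Rightarrow> bool" where
  "total_proper_connected G cv ce \<longleftrightarrow>
     (\<forall>u \<in> pverts G. \<forall>v \<in> pverts G. u \<noteq> v \<longrightarrow>
        (\<exists>p. total_proper_path G cv ce p \<and> hd p = u \<and> last p = v))"

text \<open>
  The infimum is over a set of natural numbers, hence a minimum when that set is nonempty (as it
  is for connected graphs). Since \<open>Inf {} = 0\<close>, a positive value is always attained.
\<close>

definition tpc :: "'a pair_pre_digraph \<Rightarrow> nat" where
  "tpc G = Inf {card (cv ` pverts G \<union> ce ` edges G) | cv ce. total_proper_connected G cv ce}"

lemma pair_graph_cartesian_product:
  assumes "pair_graph G" "pair_graph H"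
  shows "pair_graph (cartesian_product G H)"
proof -
  interpret G: pair_graph G by fact
  interpret H: pair_graph H by fact
  let ?P = "cartesian_product G H"
  have sub: "parcs ?P \<subseteq> (pverts G \<times> pverts H) \<times> (pverts G \<times> pverts H)"
    by (auto simp: cartesian_product_def)
  have fin: "finite (pverts G \<times> pverts H)"
    using G.pair_finite_verts H.pair_finite_verts by simp
  have symG: "sym (parcs G)" and symH: "sym (parcs H)"
    using G.pair_sym_arcs H.pair_sym_arcs by (simp_all add: symmetric_def)
  show ?thesis
  proof
    show "finite (parcs ?P)" using finite_subset[OF sub] fin by blast
    show "finite (pverts ?P)" using fin by (simp add: cartesian_product_def)
    show "symmetric (with_proj ?P)"
      using symG symH by (auto simp: symmetric_def cartesian_product_def sym_def)
  qed (use G.pair_no_loops H.pair_no_loops in \<open>force simp: cartesian_product_def\<close>)+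
qed

end

theory Submission
  imports Defs
begin

text \<open>
  Along a total proper path with three colors, edges and vertices alternate in a cyclic pattern
  of period 3. Hence, if the vertices are colored by residues mod 3 and every edge whose ends
  differ receives the third color, a path is total proper as soon as the color of its vertices
  changes by the same nonzero residue at each step. It therefore suffices to find a vertex
  coloring such that, of any two vertices, one reaches the other along arcs on which the color
  increases by 1. Moreover \<open>G\<close> may be replaced by a Hamiltonian path with \<open>m\<close> vertices (the
  rows) and \<open>H\<close> by a spanning star with center \<open>c\<close> (the columns). For odd \<open>m\<close> there is a coloring
  in which directed 6-cycles glue everything together; for even \<open>m\<close> and at least two leaves one
  more row is attached with the help of a special leaf. With a single leaf the color increases
  along a Hamiltonian path. Two colors never suffice, since a path between distinct nonadjacent
  vertices has an internal vertex.
\<close>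

section \<open>Mutual reachability and directed 6-cycles\<close>

text \<open>Using the converse for the second factor makes invariance under reversing all arcs,
  \<open>scc_converse\<close>, immediate.\<close>

definition scc :: "('a \<times> 'a) set \<Rightarrow> ('a \<times> 'a) set" where
  "scc R = R\<^sup>* \<inter> (R\<inverse>)\<^sup>*"

lemma scc_refl [simp]: "(x, x) \<in> scc R"
  by (simp add: scc_def)

lemma scc_sym: "(x, y) \<in> scc R \<Longrightarrow> (y, x) \<in> scc R"
  by (auto simp: scc_def rtrancl_converse)

lemma scc_trans: "(x, y) \<in> scc R \<Longrightarrow> (y, z) \<in> scc R \<Longrightarrow> (x, z) \<in> scc R"
  by (auto simp: scc_def)

lemma scc_converse: "scc (R\<inverse>) = scc R"
  by (auto simp: scc_def)

lemma scc_rtrancl: "(x, y) \<in> scc R \<Longrightarrow> (x, y) \<in> R\<^sup>*"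
  by (simp add: scc_def)

lemma scc_six_cycle:
  assumes "(a, b) \<in> R" "(b, c) \<in> R" "(c, d) \<in> R" "(d, e) \<in> R" "(e, f) \<in> R" "(f, a) \<in> R"
    and "x \<in> {a, b, c, d, e, f}" "y \<in> {a, b, c, d, e, f}"
  shows "(x, y) \<in> scc R"
proof -
  have forth: "(a, z) \<in> R\<^sup>*" and ret: "(z, a) \<in> R\<^sup>*" if "z \<in> {a, b, c, d, e, f}" for z
    using that assms(1-6) by (auto intro: rtrancl_into_rtrancl converse_rtrancl_into_rtrancl)
  have "(z, a) \<in> scc R" if "z \<in> {a, b, c, d, e, f}" for z
    using forth[OF that] ret[OF that] by (simp add: scc_def rtrancl_converse)
  then show ?thesis
    using assms(7,8) by (meson scc_sym scc_trans)
qed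

section \<open>Colorings of the product of a path and a star\<close>

text \<open>Unilateral connectedness of a digraph; one direction is enough because a total proper
  path can be read backwards.\<close>

definition unilateral_on :: "'a set \<Rightarrow> ('a \<times> 'a) set \<Rightarrow> bool" where
  "unilateral_on V R \<longleftrightarrow> (\<forall>u\<in>V. \<forall>v\<in>V. (u, v) \<in> R\<^sup>* \<or> (v, u) \<in> R\<^sup>*)"

text \<open>Path of rows times star centered at \<open>c\<close>: an edge whose end colors differ
  mod 3 becomes exactly one arc, any other edge none.\<close>

definition arrows :: "nat \<Rightarrow> 'b \<Rightarrow> 'b set \<Rightarrow> (nat \<Rightarrow> 'b \<Rightarrow> nat) \<Rightarrow> ((nat \<times> 'b) \<times> (nat \<times> 'b)) set" where
  "arrows m c V F = {((r, x), (s, y)). r < m \<and> s < m \<and> x \<in> V \<and> y \<in> V \<and>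
     (x = y \<and> (s = Suc r \<or> r = Suc s) \<or> r = s \<and> x \<noteq> y \<and> (x = c \<or> y = c)) \<and>
     F s y mod 3 = Suc (F r x) mod 3}"

text \<open>
  The sequence 0, 1, 2, 1, 0, 1, 2, 1, \<open>\<dots>\<close>. If a leaf column is colored by \<open>wave\<close> and the center
  column by \<open>2 - wave\<close>, the rows \<open>2 * j\<close>, \<open>2 * j + 1\<close>, \<open>2 * j + 2\<close> of these two columns form a
  directed 6-cycle, and consecutive 6-cycles share a row.
\<close>

definition wave :: "nat \<Rightarrow> nat" where
  "wave r = (if even r then r mod 4 else 1)"

lemma wave_even: "wave (2 * j) = 0 \<and> wave (2 * j + 2) = 2 \<or> wave (2 * j) = 2 \<and> wave (2 * j + 2) = 0"
  unfolding wave_def by simp presburger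

lemma wave_odd: "wave (Suc (2 * j)) = 1"
  by (simp add: wave_def)

text \<open>Down the leaf column and back up the center column the colors read 0, 1, 2, 0, 1, 2, or
  this in reverse when \<open>wave (2 * j) = 2\<close>. The offset \<open>s\<close> is 1 in the even
  case.\<close>

lemma wave_block:
  assumes F: "\<And>r. r \<le> 2 * b \<Longrightarrow> F (s + r) l = wave r \<and> F (s + r) c = 2 - wave r"
    and m: "s + 2 * b < m" and "c \<in> V" "l \<in> V" "l \<noteq> c" "j < b"
    and r: "2 * j \<le> r" "r \<le> 2 * j + 2" and x: "x \<in> {l, c}"
  shows "((s + r, x), (s + 2 * j, c)) \<in> scc (arrows m c V F)"
proof -
  let ?R = "arrows m c V F"
  let ?a = "\<lambda>i. (s + (2 * j + i), l)" and ?c = "\<lambda>i. (s + (2 * j + i), c)"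
  have r': "r = 2 * j + 0 \<or> r = 2 * j + 1 \<or> r = 2 * j + 2"
    using r by linarith
  have mem: "(s + r, x) \<in> {?a 0, ?a 1, ?a 2, ?c 2, ?c 1, ?c 0}"
    "(s + 2 * j, c) \<in> {?a 0, ?a 1, ?a 2, ?c 2, ?c 1, ?c 0}"
    using r' x by auto
  have F': "F (s + (2 * j + i)) l = wave (2 * j + i)" "F (s + (2 * j + i)) c = 2 - wave (2 * j + i)"
    if "i \<le> 2" for i using F[of "2 * j + i"] that \<open>j < b\<close> by auto
  note ev = F'[of 0, simplified] F'[of 1, simplified] F'[of 2, simplified]
  from wave_even[of j] show ?thesis
  proof (elim disjE conjE)
    assume w: "wave (2 * j) = 0" "wave (2 * j + 2) = 2"
    have "(?a 0, ?a 1) \<in> ?R" "(?a 1, ?a 2) \<in> ?R" "(?a 2, ?c 2) \<in> ?R"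
      "(?c 2, ?c 1) \<in> ?R" "(?c 1, ?c 0) \<in> ?R" "(?c 0, ?a 0) \<in> ?R"
      using assms(2-6) ev w wave_odd[of j] by (auto simp: arrows_def)
    from scc_six_cycle[OF this mem] show ?thesis .
  next
    assume w: "wave (2 * j) = 2" "wave (2 * j + 2) = 0"
    have "(?a 0, ?a 1) \<in> ?R\<inverse>" "(?a 1, ?a 2) \<in> ?R\<inverse>" "(?a 2, ?c 2) \<in> ?R\<inverse>"
      "(?c 2, ?c 1) \<in> ?R\<inverse>" "(?c 1, ?c 0) \<in> ?R\<inverse>" "(?c 0, ?a 0) \<in> ?R\<inverse>"
      using assms(2-6) ev w wave_odd[of j] by (auto simp: arrows_def)
    from scc_six_cycle[OF this mem] show ?thesis by (simp add: scc_converse)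
  qed
qed

text \<open>Chaining the blocks leads back to row \<open>s\<close>. For \<open>b = 0\<close> there
  is no block, hence the hypothesis \<open>base\<close>.\<close>

lemma wave_scc:
  assumes F: "\<And>r. r \<le> 2 * b \<Longrightarrow> F (s + r) l = wave r \<and> F (s + r) c = 2 - wave r"
    and m: "s + 2 * b < m" and V: "c \<in> V" "l \<in> V" "l \<noteq> c"
    and base: "((s, l), (s, c)) \<in> scc (arrows m c V F)"
    and r: "r \<le> 2 * b" and x: "x \<in> {l, c}"
  shows "((s + r, x), (s, c)) \<in> scc (arrows m c V F)"
proof -
  note block = wave_block[OF F m V]
  have even_rows: "j \<le> b \<Longrightarrow> ((s + 2 * j, c), (s, c)) \<in> scc (arrows m c V F)" for j
  proof (induction j)
    case (Suc j)
    from block[of j "2 * j + 2" c] Suc show ?case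
      by (auto intro: scc_trans)
  qed simp
  show ?thesis
  proof (cases "r = 0")
    case True
    then show ?thesis using base x by auto
  next
    case False
    \<comment> \<open>Rounding with \<open>r - 1\<close> puts an even row into the block that ends
      at it, so that \<open>r = 2 * b\<close> still gives \<open>j < b\<close>.\<close>
    define j where "j = (r - 1) div 2"
    have "j < b" "2 * j \<le> r" "r \<le> 2 * j + 2"
      using r False by (auto simp: j_def)
    then show ?thesis
      using block[OF _ _ _ _ x, of j r] even_rows[of j] by (auto intro: scc_trans)
  qed
qed

lemma descending_chain:
  assumes "\<And>r. s \<le> r \<Longrightarrow> r < t \<Longrightarrow> (a (Suc r), a r) \<in> R"
    and "s \<le> t"
  shows "(a t, a s) \<in> R\<^sup>*"
  using assms(2,1)
proof (induction t rule: dec_induct)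
  case (step n)
  then show ?case
    by (meson converse_rtrancl_into_rtrancl le_refl lessI less_SucI)
qed simp

text \<open>Blocks fill an odd number of rows exactly, and equally colored leaf columns are all tied
  to the one center column.\<close>

lemma ex_unilateral_odd:
  assumes "odd m" "m \<ge> 2" "L \<noteq> {}" "c \<notin> L"
  shows "\<exists>F. unilateral_on ({..<m} \<times> insert c L) (arrows m c (insert c L) F)"
proof -
  let ?F = "\<lambda>r x. if x = c then 2 - wave r else wave r"
  let ?R = "arrows m c (insert c L) ?F"
  obtain b where b: "m = Suc (2 * b)" using \<open>odd m\<close> by (elim oddE) simp
  with \<open>m \<ge> 2\<close> have "0 < b" by simp
  have leaf: "((r, x), (0, c)) \<in> scc ?R" if "l \<in> L" "r < m" "x \<in> {l, c}" for r x l
  proof -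
    have l: "l \<noteq> c" using that \<open>c \<notin> L\<close> by auto
    have F: "\<And>r. r \<le> 2 * b \<Longrightarrow> ?F (0 + r) l = wave r \<and> ?F (0 + r) c = 2 - wave r"
      using l by simp
    have m: "0 + 2 * b < m" using b by simp
    have base: "((0, l), (0, c)) \<in> scc ?R"
      using wave_block[OF F m _ _ l \<open>0 < b\<close>, of "insert c L" 0 l] that by simp
    show ?thesis
      using wave_scc[OF F m _ _ l base, of r x] that b by simp
  qed
  have "(u, (0, c)) \<in> scc ?R" if "u \<in> {..<m} \<times> insert c L" for u
    using that leaf \<open>L \<noteq> {}\<close> by fastforce
  then have "unilateral_on ({..<m} \<times> insert c L) ?R"
    unfolding unilateral_on_def by (meson scc_rtrancl scc_sym scc_trans)
  then show ?thesis by blast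
qed

text \<open>
  Rows from 1 on of the columns other than \<open>k\<close> carry the coloring of the odd case. Row 0 is joined
  to them by the 6-cycle from \<open>(1, l)\<close> through \<open>(0, l)\<close>, \<open>(0, c)\<close>, \<open>(0, k)\<close>, \<open>(1, k)\<close>, \<open>(1, c)\<close>, and
  the rest of column \<open>k\<close> is a directed path into \<open>(1, k)\<close>.
\<close>

lemma ex_unilateral_even:
  assumes "even m" "m \<ge> 2" "k \<in> L" "L - {k} \<noteq> {}" "c \<notin> L"
  shows "\<exists>F. unilateral_on ({..<m} \<times> insert c L) (arrows m c (insert c L) F)"
proof -
  \<comment> \<open>Modulo 3, \<open>2 + 2 * r\<close> is 2 - r, so in column \<open>k\<close> the
    color rises towards row 1. The values in row 0 make the joining 6-cycle read 0, 1, 2, 0, 1, 2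
    from \<open>(1, l)\<close>.\<close>
  let ?F = "\<lambda>r x. if x = k then (if r = 0 then 0 else 2 + 2 * r)
    else if r = 0 then (if x = c then 2 else 1)
    else if x = c then 2 - wave (r - 1) else wave (r - 1)"
  let ?R = "arrows m c (insert c L) ?F"
  obtain b where b: "m = 2 * b + 2"
    using \<open>even m\<close> \<open>m \<ge> 2\<close> by (metis add.commute dvdE le_Suc_ex mult_2_right dvd_add_right_iff dvd_refl)
  have k: "k \<noteq> c" using assms by auto
  have cyc: "(u, (1, c)) \<in> scc ?R"
    if "l \<in> L - {k}" "u \<in> {(1, l), (0, l), (0, c), (0, k), (1, k), (1, c)}" for u l
  proof -
    have l: "l \<noteq> c" "l \<noteq> k" "l \<in> L" using that \<open>c \<notin> L\<close> by auto
    have "((1, l), (0, l)) \<in> ?R" "((0, l), (0, c)) \<in> ?R" "((0, c), (0, k)) \<in> ?R"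
      "((0, k), (1, k)) \<in> ?R" "((1, k), (1, c)) \<in> ?R" "((1, c), (1, l)) \<in> ?R"
      using l k assms by (auto simp: arrows_def wave_def)
    from scc_six_cycle[OF this that(2), of "(1, c)"] show ?thesis by simp
  qed
  have leaf: "((r, x), (1, c)) \<in> scc ?R" if "l \<in> L - {k}" "r < m" "x \<in> {l, c}" for r x l
  proof (cases "r = 0")
    case True
    then show ?thesis using cyc[OF that(1)] that(3) by auto
  next
    case False
    have l: "l \<noteq> c" "l \<noteq> k" "l \<in> L" using that \<open>c \<notin> L\<close> by auto
    have F: "\<And>r. r \<le> 2 * b \<Longrightarrow> ?F (1 + r) l = wave r \<and> ?F (1 + r) c = 2 - wave r"
      using l k by simp
    have m: "1 + 2 * b < m" using b by simp
    have base: "((1, l), (1, c)) \<in> scc ?R" using cyc[OF that(1)] by simp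
    show ?thesis
      using wave_scc[OF F m _ _ l(1) base, of "r - 1" x] that b False by simp
  qed
  obtain l where l: "l \<in> L - {k}" using assms by blast
  \<comment> \<open>Everything except the tail of column \<open>k\<close> from row 2 on lies in one
    strong component.\<close>
  have main: "((r, x), (1, c)) \<in> scc ?R" if "r < m" "x \<in> insert c L" "x = k \<Longrightarrow> r < 2" for r x
  proof (cases "x = k")
    case True
    with that have "r = 0 \<or> r = 1" by auto
    then show ?thesis using True cyc[OF l] by auto
  next
    case False
    then show ?thesis using leaf[OF l, of r x] leaf[of x r x] that by auto
  qed
  have chain: "((t, k), (s, k)) \<in> ?R\<^sup>*" if "1 \<le> s" "s \<le> t" "t < m" for s t
  proof (rule descending_chain[where a = "\<lambda>i. (i, k)"])
    fix r assume "s \<le> r" "r < t"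
    then show "((Suc r, k), (r, k)) \<in> ?R"
      using that \<open>k \<in> L\<close> using mod_add_self2[of "2 + 2 * r" 3] by (auto simp: arrows_def)
  qed (use that in auto)
  have into: "((r, x), (1, c)) \<in> ?R\<^sup>*" if "r < m" "x \<in> insert c L" for r x
  proof (cases "x = k \<and> 2 \<le> r")
    case True
    then have "((r, k), (1, k)) \<in> ?R\<^sup>*" using chain[of 1 r] that by simp
    moreover have "((1, k), (1, c)) \<in> ?R\<^sup>*" using scc_rtrancl[OF main[of 1 k]] assms by simp
    ultimately show ?thesis using True by auto
  next
    case False
    then show ?thesis using main[of r x] that by (auto intro!: scc_rtrancl)
  qed
  \<comment> \<open>A vertex off the tail is reached from everywhere; two tail vertices are
    comparable by \<open>chain\<close>.\<close>
  have "((r, x), (s, y)) \<in> ?R\<^sup>* \<or> ((s, y), (r, x)) \<in> ?R\<^sup>*"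
    if *: "r < m" "x \<in> insert c L" "s < m" "y \<in> insert c L" for r x s y
  proof (cases "(x = k \<longrightarrow> r < 2) \<or> (y = k \<longrightarrow> s < 2)")
    case True
    then show ?thesis
      using main[of r x] main[of s y] into[of r x] into[of s y] *
      by (meson scc_rtrancl scc_sym rtrancl_trans)
  next
    case False
    then show ?thesis
      using chain[of r s] chain[of s r] * by (cases "r \<le> s") auto
  qed
  then have "unilateral_on ({..<m} \<times> insert c L) ?R"
    unfolding unilateral_on_def by blast
  then show ?thesis by blast
qed

text \<open>The path climbs the center column from row \<open>m - 1\<close> to row 0, crosses to
  \<open>(0, k)\<close> and descends column \<open>k\<close>.\<close>

lemma ex_unilateral_ladder:
  assumes "m \<ge> 2" "k \<noteq> c"
  shows "\<exists>F. unilateral_on ({..<m} \<times> {c, k}) (arrows m c {c, k} F)"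
proof -
  let ?F = "\<lambda>r x. if x = c then 2 + 2 * r else r"
  let ?R = "arrows m c {c, k} ?F"
  have C: "((t, c), (s, c)) \<in> ?R\<^sup>*" if "s \<le> t" "t < m" for s t
  proof (rule descending_chain[where a = "\<lambda>i. (i, c)"])
    fix r assume "s \<le> r" "r < t"
    then show "((Suc r, c), (r, c)) \<in> ?R"
      using that using mod_add_self2[of "2 + 2 * r" 3] by (auto simp: arrows_def)
  qed (use that in auto)
  have "((t, k), (s, k)) \<in> (?R\<inverse>)\<^sup>*" if "s \<le> t" "t < m" for s t
  proof (rule descending_chain[where a = "\<lambda>i. (i, k)"])
    fix r assume "s \<le> r" "r < t"
    then show "((Suc r, k), (r, k)) \<in> ?R\<inverse>"
      using that assms by (simp add: arrows_def)
  qed (use that in auto)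
  then have K: "((s, k), (t, k)) \<in> ?R\<^sup>*" if "s \<le> t" "t < m" for s t
    using that by (simp add: rtrancl_converse)
  have "((0, c), (0, k)) \<in> ?R" using assms by (simp add: arrows_def)
  then have CK: "((s, c), (t, k)) \<in> ?R\<^sup>*" if "s < m" "t < m" for s t
    using C[of 0 s] K[of 0 t] that by (meson le0 rtrancl.rtrancl_into_rtrancl rtrancl_trans)
  have "(u, v) \<in> ?R\<^sup>* \<or> (v, u) \<in> ?R\<^sup>*"
    if uv: "u \<in> {..<m} \<times> {c, k}" "v \<in> {..<m} \<times> {c, k}" for u v
  proof -
    obtain r x s y where [simp]: "u = (r, x)" "v = (s, y)" by fastforce
    have m: "r < m" "s < m" using uv by auto
    consider "x = c" "y = c" | "x = k" "y = k" | "x = c" "y = k" | "x = k" "y = c"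
      using uv by auto
    then show ?thesis
      by cases (use m C[of r s] C[of s r] K[of r s] K[of s r] CK[of r s] CK[of s r]
        linear[of r s] in simp_all, blast+)
  qed
  then have "unilateral_on ({..<m} \<times> {c, k}) ?R"
    unfolding unilateral_on_def by blast
  then show ?thesis by blast
qed

lemma ex_unilateral:
  assumes m: "m \<ge> 2" and L: "L \<noteq> {}" "c \<notin> L"
  shows "\<exists>F. unilateral_on ({..<m} \<times> insert c L) (arrows m c (insert c L) F)"
proof -
  obtain k where k: "k \<in> L" using \<open>L \<noteq> {}\<close> by blast
  consider "odd m" | "L = {k}" | "even m" "L - {k} \<noteq> {}"
    using k by blast
  then show ?thesis
  proof cases
    case 1
    from ex_unilateral_odd[OF 1 m L] show ?thesis .
  next
    case 2
    then have "k \<noteq> c" using L by blast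
    from ex_unilateral_ladder[OF m this] show ?thesis unfolding 2 .
  next
    case 3
    from ex_unilateral_even[OF 3(1) m k 3(2) L(2)] show ?thesis .
  qed
qed

section \<open>From reachability to total proper paths\<close>

lemma set_vwalk_arcs_subset_iff:
  "set (vwalk_arcs p) \<subseteq> R \<longleftrightarrow> successively (\<lambda>x y. (x, y) \<in> R) p"
  by (induction p rule: vwalk_arcs.induct) auto

text \<open>Loop erasure: if the new first vertex already occurs, the path is cut back to the suffix
  starting there.\<close>

lemma rtrancl_distinct_path:
  assumes "(u, v) \<in> R\<^sup>*" "R \<subseteq> V \<times> V" "v \<in> V"
  shows "\<exists>p. p \<noteq> [] \<and> hd p = u \<and> last p = v \<and> distinct p \<and> set p \<subseteq> V \<and>
    successively (\<lambda>x y. (x, y) \<in> R) p"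
  using assms(1)
proof (induction rule: converse_rtrancl_induct)
  case base
  show ?case by (rule exI[of _ "[v]"]) (use \<open>v \<in> V\<close> in simp)
next
  case (step u w)
  then obtain p where p: "p \<noteq> []" "hd p = w" "last p = v" "distinct p" "set p \<subseteq> V"
    "successively (\<lambda>x y. (x, y) \<in> R) p" by blast
  show ?case
  proof (cases "u \<in> set p")
    case True
    then obtain xs ys where "p = xs @ u # ys" by (meson split_list)
    then show ?thesis
      using p by (intro exI[of _ "u # ys"]) (auto simp: successively_append_iff)
  next
    case False
    then show ?thesis
      using p step.hyps(1) assms(2)
      by (intro exI[of _ "u # p"]) (auto simp: successively_Cons)
  qed
qed

text \<open>Since 0 + 1 + 2 vanishes mod 3, the residue missed by distinct \<open>a\<close> and
  \<open>b\<close> is -(a + b), that is, \<open>2 * (a + b)\<close>. The shifts 1 and 2 are the two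
  directions of travel.\<close>

lemma third_colour:
  fixes a b s :: nat
  assumes "b mod 3 = (a + s) mod 3" "s = 1 \<or> s = 2"
  shows "a mod 3 \<noteq> b mod 3" "2 * (a + b) mod 3 \<noteq> a mod 3" "2 * (a + b) mod 3 \<noteq> b mod 3"
proof -
  have red: "2 * (a + b) mod 3 = 2 * (a mod 3 + b mod 3) mod 3"
    by (metis mod_add_eq mod_mult_right_eq)
  have b: "b mod 3 = (a mod 3 + s) mod 3"
    unfolding assms(1) by (simp only: mod_simps)
  consider "a mod 3 = 0" | "a mod 3 = 1" | "a mod 3 = 2" by linarith
  then show "a mod 3 \<noteq> b mod 3" "2 * (a + b) mod 3 \<noteq> a mod 3" "2 * (a + b) mod 3 \<noteq> b mod 3"
    unfolding red b using assms(2) by (cases; auto)+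
qed

text \<open>Modulo 3 the two edges get a + 2s and a + 3s = a, and 2s is nonzero.\<close>

lemma third_colour_neq:
  fixes a b c s :: nat
  assumes "b mod 3 = (a + s) mod 3" "c mod 3 = (b + s) mod 3" "s = 1 \<or> s = 2"
  shows "2 * (a + b) mod 3 \<noteq> 2 * (b + c) mod 3"
proof -
  have red: "2 * (x + y) mod 3 = 2 * (x mod 3 + y mod 3) mod 3" for x y :: nat
    by (metis mod_add_eq mod_mult_right_eq)
  have b: "b mod 3 = (a mod 3 + s) mod 3"
    unfolding assms(1) by (simp only: mod_simps)
  have c: "c mod 3 = (b mod 3 + s) mod 3"
    unfolding assms(2) by (simp only: mod_simps)
  consider "a mod 3 = 0" | "a mod 3 = 1" | "a mod 3 = 2" by linarith
  then show ?thesis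
    unfolding red[of a b] red[of b c] c b using assms(3) by cases auto
qed

text \<open>Writing the edge color with \<open>sum f e\<close> makes it a function of the edge as a
  set; distinctness of the path gives the sum two terms.\<close>

lemma rotating_total_proper_path:
  fixes f :: "'a \<Rightarrow> nat"
  assumes P: "pair_graph P" and s: "s = 1 \<or> s = 2" and v: "v \<in> pverts P"
    and reach: "(u, v) \<in> {(x, y) \<in> parcs P. f y mod 3 = (f x + s) mod 3}\<^sup>*"
  shows "\<exists>p. total_proper_path P (\<lambda>x. f x mod 3) (\<lambda>e. 2 * sum f e mod 3) p \<and> hd p = u \<and> last p = v"
proof -
  interpret pair_graph P by fact
  let ?R = "{(x, y) \<in> parcs P. f y mod 3 = (f x + s) mod 3}"
  have "?R \<subseteq> pverts P \<times> pverts P"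
    using in_arcsD1 in_arcsD2 by fastforce
  from rtrancl_distinct_path[OF reach this v] obtain p where
    p: "p \<noteq> []" "hd p = u" "last p = v" "distinct p" "set p \<subseteq> pverts P"
      "successively (\<lambda>x y. (x, y) \<in> ?R) p"
    by blast
  have "successively (\<lambda>x y. (x, y) \<in> parcs P) p"
    by (rule successively_mono[OF p(6)]) simp
  then have vp: "vpath p (with_proj P)"
    using p by (simp add: vpath_def vwalk_def set_vwalk_arcs_subset_iff)
  have step: "f (p ! Suc i) mod 3 = (f (p ! i) + s) mod 3" if "Suc i < length p" for i
    using p(6) that by (auto simp: successively_conv_nth)
  have edge: "sum f {p ! i, p ! Suc i} = f (p ! i) + f (p ! Suc i)" if "Suc i < length p" for i
    using p(4) that by (simp add: nth_eq_iff_index_eq)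
  have adj: "2 * (f (p ! i) + f (p ! Suc i)) mod 3 \<noteq> 2 * (f (p ! Suc i) + f (p ! Suc (Suc i))) mod 3"
    if "Suc (Suc i) < length p" for i
    using third_colour_neq[OF step step s] that by simp
  have col: "f (p ! i) mod 3 \<noteq> f (p ! Suc i) mod 3"
    "2 * (f (p ! i) + f (p ! Suc i)) mod 3 \<noteq> f (p ! i) mod 3"
    "2 * (f (p ! i) + f (p ! Suc i)) mod 3 \<noteq> f (p ! Suc i) mod 3" if "Suc i < length p" for i
    using third_colour[OF step[OF that] s] .
  have "total_proper_path P (\<lambda>x. f x mod 3) (\<lambda>e. 2 * sum f e mod 3) p"
    unfolding total_proper_path_def
  proof (intro conjI allI impI)
    show "vpath p (with_proj P)" by fact
  next
    fix i assume "i + 2 < length p"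
    then show "2 * sum f {p ! i, p ! (i + 1)} mod 3 \<noteq> 2 * sum f {p ! (i + 1), p ! (i + 2)} mod 3"
      using adj[of i] edge[of i] edge[of "Suc i"] by simp
  next
    fix i assume "0 < i \<and> i + 2 < length p"
    then show "f (p ! i) mod 3 \<noteq> f (p ! (i + 1)) mod 3" using col(1)[of i] by simp
  next
    fix i assume "0 < i \<and> i + 1 < length p"
    then show "f (p ! i) mod 3 \<noteq> 2 * sum f {p ! (i - 1), p ! i} mod 3"
      using col(3)[of "i - 1"] edge[of "i - 1"] by simp
  next
    fix i assume "0 < i \<and> i + 1 < length p"
    then show "f (p ! i) mod 3 \<noteq> 2 * sum f {p ! i, p ! (i + 1)} mod 3"
      using col(2)[of i] edge[of i] by simp
  qed
  with p show ?thesis by blast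
qed

text \<open>If only \<open>v\<close> reaches \<open>u\<close>, the reversed walk has shift 2,
  because -1 = 2 mod 3.\<close>

lemma unilateral_imp_total_proper_connected:
  fixes f :: "'a \<Rightarrow> nat"
  assumes P: "pair_graph P"
    and uni: "unilateral_on (pverts P) {(x, y) \<in> parcs P. f y mod 3 = Suc (f x) mod 3}"
  shows "total_proper_connected P (\<lambda>x. f x mod 3) (\<lambda>e. 2 * sum f e mod 3)"
  unfolding total_proper_connected_def
proof (intro ballI impI)
  interpret pair_graph P by fact
  fix u v assume uv: "u \<in> pverts P" "v \<in> pverts P"
  let ?R = "\<lambda>s. {(x, y) \<in> parcs P. f y mod 3 = (f x + s) mod 3}"
  have sym: "(y, x) \<in> parcs P" if "(x, y) \<in> parcs P" for x y
    using pair_sym_arcs that by (auto simp: symmetric_def dest: symD)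
  have "f x mod 3 = (f y + 2) mod 3" if "f y mod 3 = (f x + 1) mod 3" for x y
    using that by presburger
  then have "(?R 1)\<inverse> \<subseteq> ?R 2"
    using sym by blast
  then have conv: "((?R 1)\<inverse>)\<^sup>* \<subseteq> (?R 2)\<^sup>*" by (rule rtrancl_mono)
  have "(u, v) \<in> (?R 1)\<^sup>* \<or> (v, u) \<in> (?R 1)\<^sup>*"
    using uni uv by (simp add: unilateral_on_def)
  then have "(u, v) \<in> (?R 1)\<^sup>* \<or> (u, v) \<in> (?R 2)\<^sup>*"
    using conv by (auto simp: rtrancl_converse)
  then show "\<exists>p. total_proper_path P (\<lambda>x. f x mod 3) (\<lambda>e. 2 * sum f e mod 3) p \<and> hd p = u \<and> last p = v"
  proof
    assume "(u, v) \<in> (?R 1)\<^sup>*"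
    from rotating_total_proper_path[OF P _ uv(2) this] show ?thesis by simp
  next
    assume "(u, v) \<in> (?R 2)\<^sup>*"
    from rotating_total_proper_path[OF P _ uv(2) this] show ?thesis by simp
  qed
qed

section \<open>Lower bound and the value of \<open>tpc\<close>\<close>

text \<open>The first internal vertex of the path and its two path edges have pairwise distinct
  colors.\<close>

lemma total_proper_connected_three_le:
  assumes P: "pair_graph P" and con: "total_proper_connected P cv ce"
    and uv: "u \<in> pverts P" "v \<in> pverts P" "u \<noteq> v" "(u, v) \<notin> parcs P"
  shows "3 \<le> card (cv ` pverts P \<union> ce ` edges P)"
proof -
  interpret pair_graph P by fact
  obtain p where p: "total_proper_path P cv ce p" "hd p = u" "last p = v"
    using con uv by (auto simp: total_proper_connected_def)
  then have w: "set p \<subseteq> pverts P" "p \<noteq> []" "successively (\<lambda>x y. (x, y) \<in> parcs P) p"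
    by (auto simp: total_proper_path_def vpath_def vwalk_def set_vwalk_arcs_subset_iff)
  obtain x y z q where xyz: "p = x # y # z # q"
  proof -
    obtain x p' where "p = x # p'" using w(2) by (cases p) auto
    moreover from this obtain y p'' where "p' = y # p''" using p(2,3) uv(3) by (cases p') auto
    moreover from calculation obtain z q where "p'' = z # q"
      using p(2,3) uv(4) w(3) by (cases p'') auto
    ultimately show thesis using that by simp
  qed
  have "ce {x, y} \<noteq> ce {y, z}" "cv y \<noteq> ce {x, y}" "cv y \<noteq> ce {y, z}"
    using p(1) unfolding total_proper_path_def xyz
    by (force dest: spec[of _ 0] spec[of _ 1])+
  then have "3 = card {cv y, ce {x, y}, ce {y, z}}" by simp
  also have "\<dots> \<le> card (cv ` pverts P \<union> ce ` edges P)"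
  proof (rule card_mono)
    have "edges P = (\<lambda>(u, v). {u, v}) ` parcs P"
      by (auto simp: edges_def)
    then show "finite (cv ` pverts P \<union> ce ` edges P)"
      by simp
    show "{cv y, ce {x, y}, ce {y, z}} \<subseteq> cv ` pverts P \<union> ce ` edges P"
      using w unfolding xyz edges_def by (simp, blast)
  qed
  finally show ?thesis .
qed

lemma tpc_eq_3:
  fixes f :: "'a \<Rightarrow> nat"
  assumes P: "pair_graph P"
    and uni: "unilateral_on (pverts P) {(x, y) \<in> parcs P. f y mod 3 = Suc (f x) mod 3}"
    and uv: "u \<in> pverts P" "v \<in> pverts P" "u \<noteq> v" "(u, v) \<notin> parcs P"
  shows "tpc P = 3"
proof -
  let ?cv = "\<lambda>x. f x mod 3" and ?ce = "\<lambda>e. 2 * sum f e mod 3"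
  have con: "total_proper_connected P ?cv ?ce"
    by (rule unilateral_imp_total_proper_connected[OF P uni])
  have "card (?cv ` pverts P \<union> ?ce ` edges P) \<le> card {..<3::nat}"
    by (rule card_mono) auto
  then have "card (?cv ` pverts P \<union> ?ce ` edges P) = 3"
    using total_proper_connected_three_le[OF P con uv] by simp
  with con show ?thesis
    unfolding tpc_def
    by (intro cInf_eq_minimum CollectI exI[of _ ?cv] exI[of _ ?ce] conjI)
      (auto intro: total_proper_connected_three_le[OF P _ uv])
qed

section \<open>Spanning star and transfer to the product\<close>

text \<open>A vertex of maximum degree has as many neighbors as there are other vertices, so it is
  the center of a spanning star.\<close>

lemma max_degree_dominating_vertex:
  assumes H: "pair_graph H" and ne: "pverts H \<noteq> {}"
    and deg: "max_degree H = card (pverts H) - 1"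
  shows "\<exists>c\<in>pverts H. \<forall>h\<in>pverts H. h \<noteq> c \<longrightarrow> (c, h) \<in> parcs H"
proof -
  interpret pair_graph H by fact
  have "max_degree H \<in> out_degree (with_proj H) ` pverts H"
    unfolding max_degree_def using ne by (intro Max_in) auto
  then obtain c where c: "c \<in> pverts H" "out_degree (with_proj H) c = card (pverts H) - 1"
    using deg by auto
  let ?N = "{h. (c, h) \<in> parcs H}"
  have "out_arcs (with_proj H) c = Pair c ` ?N"
    by (auto simp: out_arcs_def)
  then have "card ?N = card (pverts H - {c})"
    using c by (simp add: out_degree_def card_image inj_on_def)
  moreover have "?N \<subseteq> pverts H - {c}"
    using in_arcsD2 pair_no_loops by fastforce
  ultimately have "?N = pverts H - {c}"
    by (simp add: card_subset_eq)
  then show ?thesis using c by blast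
qed

theorem theorem3p2:
  fixes G :: "'a pair_pre_digraph" and H :: "'b pair_pre_digraph"
  assumes "pair_graph G" and "card (pverts G) \<ge> 2" and "traceable G"
    and "pair_graph H" and "card (pverts H) \<ge> 2" and "connected (with_proj H)"
    and "max_degree H = card (pverts H) - 1"
  shows "tpc (cartesian_product G H) = 3"
proof -
  interpret G: pair_graph G by fact
  interpret H: pair_graph H by fact
  let ?P = "cartesian_product G H"
  have P: "pair_graph ?P" using assms by (intro pair_graph_cartesian_product)
  obtain p where p: "distinct p" "set p = pverts G" "successively (\<lambda>x y. (x, y) \<in> parcs G) p"
    using \<open>traceable G\<close>
    by (auto simp: traceable_def vpath_def vwalk_def set_vwalk_arcs_subset_iff)
  define m where "m = length p"
  have m: "m \<ge> 2" using p assms(2) distinct_card[of p] by (simp add: m_def)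
  have rows: "(p ! i, p ! Suc i) \<in> parcs G" "(p ! Suc i, p ! i) \<in> parcs G" if "Suc i < m" for i
    using p(3) that G.pair_sym_arcs
    by (auto simp: successively_conv_nth m_def symmetric_def dest: symD)
  have in_G: "p ! i \<in> pverts G" if "i < m" for i
    using that p(2) m_def nth_mem by blast
  obtain c where c: "c \<in> pverts H" "\<And>h. h \<in> pverts H \<Longrightarrow> h \<noteq> c \<Longrightarrow> (c, h) \<in> parcs H"
    using max_degree_dominating_vertex[of H] assms by fastforce
  then have c': "\<And>h. h \<in> pverts H \<Longrightarrow> h \<noteq> c \<Longrightarrow> (h, c) \<in> parcs H"
    using H.pair_sym_arcs by (auto simp: symmetric_def dest: symD)
  define L where "L = pverts H - {c}"
  have V: "insert c L = pverts H" using c by (auto simp: L_def)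
  have "L \<noteq> {}"
    using assms(5) V by (intro notI) (simp flip: V)
  then obtain F where F: "unilateral_on ({..<m} \<times> pverts H) (arrows m c (pverts H) F)"
    using ex_unilateral[OF m, of L c] V by (auto simp: L_def)
  define row where "row = inv_into {..<m} ((!) p)"
  have row: "row (p ! i) = i" if "i < m" for i
    unfolding row_def using that p(1) by (intro inv_into_f_f) (auto simp: m_def intro: inj_on_nth)
  define f where "f = (\<lambda>(g, h). F (row g) h)"
  let ?D = "{(x, y) \<in> parcs ?P. f y mod 3 = Suc (f x) mod 3}"
  let ?e = "\<lambda>(i, h). (p ! i, h)"
  \<comment> \<open>Path and star edges are edges of \<open>G\<close> and \<open>H\<close>, and
    \<open>row\<close> undoes the indexing by \<open>p\<close>, so grid arcs become product arcs
    with the same colors.\<close>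
  have arrow: "(?e x, ?e y) \<in> ?D" if "(x, y) \<in> arrows m c (pverts H) F" for x y
    using that rows in_G row c c'
    by (auto simp: arrows_def cartesian_product_def f_def)
  have emb: "(?e x, ?e y) \<in> ?D\<^sup>*" if "(x, y) \<in> (arrows m c (pverts H) F)\<^sup>*" for x y
    using that
  proof induction
    case (step y z)
    then show ?case using arrow by (meson rtrancl.rtrancl_into_rtrancl)
  qed simp
  have surj: "pverts ?P = ?e ` ({..<m} \<times> pverts H)"
    using p(2) by (force simp: cartesian_product_def m_def in_set_conv_nth)
  have uni: "unilateral_on (pverts ?P) ?D"
    unfolding surj unilateral_on_def ball_simps(9)
    using F emb unfolding unilateral_on_def by meson
  \<comment> \<open>The vertices \<open>(p ! 0, c)\<close> and \<open>(p ! 1, l)\<close> differ in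
    both coordinates, so they are nonadjacent.\<close>
  obtain l where l: "l \<in> pverts H" "l \<noteq> c" using \<open>L \<noteq> {}\<close> by (auto simp: L_def)
  have "0 < length p" "1 < length p" using m by (auto simp: m_def)
  from nth_eq_iff_index_eq[OF p(1) this] have "p ! 0 \<noteq> p ! 1" by simp
  then show ?thesis
    using m c(1) l in_G[of 0] in_G[of 1]
    by (intro tpc_eq_3[OF P uni, of "(p ! 0, c)" "(p ! 1, l)"]) (auto simp: cartesian_product_def)
qed

end
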